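(* Let $n\ge m\ge 1$ be integers. With $\mathcal{R}_{n,m}$, the operators $\mathcal{T}_1[y],\dots,\mathcal{T}_m[y]$ and the notion of least common left multiple (LCLM) as in the context, the following differential operators annihilate the function $\mathcal{R}_{n,m}(x,\lambda_1,\ldots,\lambda_m)$: (i) the products $\mathcal{T}_k[\lambda_1]\,\mathcal{T}_k[\lambda_2]\cdots\mathcal{T}_k[\lambda_m]$, for $k=1,2,\ldots,m$; (ii) the least common left multiples $\mathrm{LCLM}(\mathcal{T}_1[\lambda_k],\ldots,\mathcal{T}_m[\lambda_k])$, for $k=1,2,\ldots,m$.
   Context: For a positive integer $a$, ${}_0F_1(a;z)=\sum_{k=0}^\infty \frac{z^k}{(a)_k\,k!}$ with $(a)_k=a(a+1)\cdots(a+k-1)$. For integers $k\ge 0$, $a\ge1$, put $$H^k_a(x,y)=\int_0^x t^k e^{-t}\,{}_0F_1(a;ty)\,dt .$$ For integers $n\ge m\ge1$ define $$\mathcal{R}_{n,m}(x,\lambda_1,\ldots,\lambda_m)=\frac{\partial}{\partial x}\det\Big(H^{n-j}_{n-m+1}(x,\lambda_i)\Big)_{i,j=1}^m ,$$ where $i$ is the row index and $j$ the column index. Define differential operators in $\partial/\partial y$ (with $x$ regarded as a parameter) $$\mathcal{P}_M[y]=y\frac{\partial^2}{\partial y^2}+(M+1)\frac{\partial}{\partial y}-x,$$ $$\mathcal{Q}_{N,M}[y]=y\frac{\partial^3}{\partial y^3}+(M-y+2)\frac{\partial^2}{\partial y^2}-(x+N+1)\frac{\partial}{\partial y}+x,$$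 and set $\mathcal{T}_1[y]=\mathcal{P}_{n-m}[y]$ and $\mathcal{T}_j[y]=\mathcal{Q}_{n-m+j,\,n-m}[y]$ for $2\le j\le m$. The notation $\mathcal{T}_j[\lambda_i]$ means that $y$ is replaced by $\lambda_i$ and $\partial/\partial y$ by $\partial/\partial\lambda_i$. A least common left multiple (LCLM) of differential operators $\mathcal{L}_1,\ldots,\mathcal{L}_k$ in $\mathbb{C}(x,y)\langle\partial/\partial y\rangle$ is a differential operator $\mathcal{L}^*$ of minimal order such that $\mathcal{L}^*$ is a left multiple of every $\mathcal{L}_j$, $j\in\{1,\dots,k\}$; it is unique up to left multiplication by a nonzero element of $\mathbb{C}(x,y)$. *)

theory Defs
  imports
    "HOL-Complex_Analysis.Contour_Integration"
    "HOL-Computational_Algebra.Fraction_Field"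
    "Jordan_Normal_Form.Determinant"
begin

definition hyp0F1 :: "nat \<Rightarrow> complex \<Rightarrow> complex" where
  "hyp0F1 a z = (\<Sum>k. z ^ k / (pochhammer (of_nat a) k * fact k))"

text \<open>
  The integrand is entire in \<open>t\<close>, so for complex \<open>x\<close> the integral from \<open>0\<close> to \<open>x\<close> is taken along
  the segment; for real \<open>x\<close> (of either sign) it is the ordinary integral.
\<close>

definition H_int :: "nat \<Rightarrow> nat \<Rightarrow> complex \<Rightarrow> complex \<Rightarrow> complex" where
  "H_int k a x y = contour_integral (linepath 0 x) (\<lambda>t. t ^ k * exp (- t) * hyp0F1 a (t * y))"

text \<open>
  The variables \<open>\<lambda>\<^sub>1, \<dots>, \<lambda>\<^sub>m\<close> are the values \<open>l 1, \<dots>, l m\<close>. Matrix indices start at \<open>0\<close>, hence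
  the successors.
\<close>

definition R_fun :: "nat \<Rightarrow> nat \<Rightarrow> complex \<Rightarrow> (nat \<Rightarrow> complex) \<Rightarrow> complex" where
  "R_fun n m x l =
     deriv (\<lambda>x. Determinant.det
       (Matrix.mat m m (\<lambda>(i, j). H_int (n - Suc j) (n - m + 1) x (l (Suc i))))) x"


section \<open>The field \<open>\<complex>(x,y)\<close>\<close>

text \<open>
  \<open>\<complex>(x,y)\<close> is the fraction field of \<open>\<complex>[x][y]\<close>: the outer polynomial variable is \<open>y\<close>, the inner
  one is \<open>x\<close>.
\<close>

type_synonym ratfun = "complex poly poly fract"

definition rf_x :: ratfun where "rf_x = Fract [:[:0, 1:]:] 1"

definition rf_y :: ratfun where "rf_y = Fract [:0, 1:] 1"

definition poly_xy :: "complex poly poly \<Rightarrow> complex \<Rightarrow> complex \<Rightarrow> complex" where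
  "poly_xy p x y = poly (poly p [:y:]) x"

text \<open>
  A rational function is regular at a point if some representation of it has a denominator that
  does not vanish there; its value at a point that is not regular is unspecified.
\<close>

definition rf_regular :: "ratfun \<Rightarrow> complex \<Rightarrow> complex \<Rightarrow> bool" where
  "rf_regular r x y \<longleftrightarrow> (\<exists>p q. r = Fract p q \<and> poly_xy q x y \<noteq> 0)"

definition rf_eval :: "ratfun \<Rightarrow> complex \<Rightarrow> complex \<Rightarrow> complex" where
  "rf_eval r x y =
     (THE v. \<exists>p q. r = Fract p q \<and> poly_xy q x y \<noteq> 0 \<and> v = poly_xy p x y / poly_xy q x y)"

lemma poly_xy_mult: "poly_xy (p * q) x y = poly_xy p x y * poly_xy q x y"
  by (simp add: poly_xy_def)

lemma poly_xy_0 [simp]: "poly_xy 0 x y = 0"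
  by (simp add: poly_xy_def)

lemma rf_eval_Fract:
  assumes "poly_xy q x y \<noteq> 0"
  shows "rf_eval (Fract p q) x y = poly_xy p x y / poly_xy q x y"
  unfolding rf_eval_def
proof (rule the_equality)
  fix v
  assume "\<exists>p' q'. Fract p q = Fract p' q' \<and> poly_xy q' x y \<noteq> 0 \<and> v = poly_xy p' x y / poly_xy q' x y"
  then obtain p' q' where *: "Fract p q = Fract p' q'" "poly_xy q' x y \<noteq> 0"
      "v = poly_xy p' x y / poly_xy q' x y" by blast
  have "q \<noteq> 0" "q' \<noteq> 0" using assms *(2) by auto
  then have "p * q' = p' * q" using *(1) by (simp add: eq_fract)
  then have "poly_xy p x y * poly_xy q' x y = poly_xy p' x y * poly_xy q x y"
    by (metis poly_xy_mult)
  then show "v = poly_xy p x y / poly_xy q x y"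
    using assms *(2,3) by (metis frac_eq_eq)
qed (use assms in blast)

definition rf_pderiv :: "ratfun \<Rightarrow> ratfun" where
  "rf_pderiv r =
     (THE d. \<exists>p q. q \<noteq> 0 \<and> r = Fract p q \<and> d = Fract (pderiv p * q - p * pderiv q) (q * q))"

lemma rf_pderiv_Fract:
  assumes "q \<noteq> 0"
  shows "rf_pderiv (Fract p q) = Fract (pderiv p * q - p * pderiv q) (q * q)"
  unfolding rf_pderiv_def
proof (rule the_equality)
  fix d
  assume "\<exists>p' q'. q' \<noteq> 0 \<and> Fract p q = Fract p' q' \<and>
            d = Fract (pderiv p' * q' - p' * pderiv q') (q' * q')"
  then obtain p' q' where *: "q' \<noteq> 0" "Fract p q = Fract p' q'"
      "d = Fract (pderiv p' * q' - p' * pderiv q') (q' * q')" by blast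
  have eq: "p * q' = p' * q" using * assms by (simp add: eq_fract)
  have "pderiv p * q' + p * pderiv q' = pderiv p' * q + p' * pderiv q"
    using arg_cong[OF eq, of pderiv] by (simp add: pderiv_mult algebra_simps)
  then have d: "pderiv p' * q = pderiv p * q' + p * pderiv q' - p' * pderiv q"
    by (simp add: algebra_simps)
  have "(pderiv p' * q' - p' * pderiv q') * (q * q) =
      (pderiv p' * q) * (q' * q) - (p' * q) * (pderiv q' * q)"
    by (simp add: algebra_simps)
  also have "\<dots> = pderiv p * q * (q' * q') - (p' * q) * (pderiv q * q')"
    unfolding d eq[symmetric] by (simp add: algebra_simps eq[symmetric])
  also have "\<dots> = (pderiv p * q - p * pderiv q) * (q' * q')"
    unfolding eq[symmetric] by (simp add: algebra_simps)
  finally have "(pderiv p' * q' - p' * pderiv q') * (q * q) =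
      (pderiv p * q - p * pderiv q) * (q' * q')" .
  then show "d = Fract (pderiv p * q - p * pderiv q) (q * q)"
    using * assms by (simp add: eq_fract)
qed (use assms in blast)

lemma rf_pderiv_0 [simp]: "rf_pderiv 0 = 0"
  by (simp add: Zero_fract_def rf_pderiv_Fract eq_fract)


section \<open>Differential operators in \<open>\<complex>(x,y)\<langle>\<partial>/\<partial>y\<rangle>\<close>\<close>

text \<open>
  The polynomial with coefficients \<open>c\<^sub>0, c\<^sub>1, \<dots>\<close> stands for the operator \<open>\<Sum>\<^sub>j c\<^sub>j (\<partial>/\<partial>y)\<^sup>j\<close>, with the
  coefficients on the left, so that its order is \<open>degree\<close>. The product of operators is \<open>dop_mult\<close>
  below, and not the (commutative) product of polynomials.
\<close>

type_synonym dop = "ratfun poly"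

text \<open>Left multiplication by \<open>\<partial>/\<partial>y\<close>: \<open>(\<partial>/\<partial>y) c = c (\<partial>/\<partial>y) + \<partial>c/\<partial>y\<close>.\<close>

definition D_mult :: "dop \<Rightarrow> dop" where
  "D_mult B = pCons 0 B + map_poly rf_pderiv B"

definition dop_mult :: "dop \<Rightarrow> dop \<Rightarrow> dop" where
  "dop_mult A B = (\<Sum>i\<le>degree A. Polynomial.smult (coeff A i) ((D_mult ^^ i) B))"

lemma dop_mult_D_const: "dop_mult [:0, 1:] [:c:] = [:rf_pderiv c, c:]"
  by (simp add: dop_mult_def D_mult_def map_poly_pCons)

definition left_multiple :: "dop \<Rightarrow> dop \<Rightarrow> bool" where
  "left_multiple L B \<longleftrightarrow> (\<exists>A. L = dop_mult A B)"

text \<open>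
  As an LCLM is unique only up to a nonzero left factor in \<open>\<complex>(x,y)\<close>, it is a relation. The zero
  operator, a left multiple of everything, does not compete for the minimal order.
\<close>

definition is_LCLM :: "dop set \<Rightarrow> dop \<Rightarrow> bool" where
  "is_LCLM S L \<longleftrightarrow> L \<noteq> 0 \<and> (\<forall>B\<in>S. left_multiple L B) \<and>
     (\<forall>L'. L' \<noteq> 0 \<and> (\<forall>B\<in>S. left_multiple L' B) \<longrightarrow> degree L \<le> degree L')"

definition P_op :: "nat \<Rightarrow> dop" where
  "P_op M = [:- rf_x, of_nat (M + 1), rf_y:]"

definition Q_op :: "nat \<Rightarrow> nat \<Rightarrow> dop" where
  "Q_op N M = [:rf_x, - (rf_x + of_nat N + 1), of_nat M - rf_y + 2, rf_y:]"

definition T_op :: "nat \<Rightarrow> nat \<Rightarrow> nat \<Rightarrow> dop" where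
  "T_op n m j = (if j = 1 then P_op (n - m) else Q_op (n - m + j) (n - m))"


section \<open>Action on functions of \<open>\<lambda>\<^sub>1, \<lambda>\<^sub>2, \<dots>\<close>\<close>

definition partial_deriv :: "nat \<Rightarrow> ((nat \<Rightarrow> complex) \<Rightarrow> complex) \<Rightarrow> (nat \<Rightarrow> complex) \<Rightarrow> complex" where
  "partial_deriv i f l = deriv (\<lambda>z. f (l(i := z))) (l i)"

text \<open>
  \<open>dop_act L x i f\<close> is \<open>L[\<lambda>\<^sub>i] f\<close> for the value \<open>x\<close> of the parameter. It is meaningful at points
  where \<open>dop_regular L x (l i)\<close> holds, that is, where no coefficient has a singularity.
\<close>

definition dop_regular :: "dop \<Rightarrow> complex \<Rightarrow> complex \<Rightarrow> bool" where
  "dop_regular L x y \<longleftrightarrow> (\<forall>j. rf_regular (coeff L j) x y)"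

definition dop_act ::
  "dop \<Rightarrow> complex \<Rightarrow> nat \<Rightarrow> ((nat \<Rightarrow> complex) \<Rightarrow> complex) \<Rightarrow> (nat \<Rightarrow> complex) \<Rightarrow> complex" where
  "dop_act L x i f l = (\<Sum>j\<le>degree L. rf_eval (coeff L j) x (l i) * (partial_deriv i ^^ j) f l)"

end

theory Submission
  imports
    Defs
    "HOL-Complex_Analysis.Cauchy_Integral_Formula"
begin

text \<open>
  Put \<open>M = n - m\<close> and \<open>F(z) = \<^sub>0F\<^sub>1(M + 1; z)\<close>. The columns of the matrix behind \<open>R\<close> are the integrals
  \<open>\<integral>\<^sub>0\<^sup>x t\<^sup>p t\<^sup>M e\<^sup>-\<^sup>t F(ty) dt\<close> for \<open>p = m - 1, \<dots>, 0\<close>, evaluated at \<open>y = \<lambda>\<^sub>i\<close> in row \<open>i\<close>. For a constant \<open>c\<close>,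
  unitriangular column operations replace \<open>t\<^sup>p\<close> by \<open>(t - c)\<^sup>p\<close>. Differentiating in \<open>x\<close> and choosing \<open>c = x\<close>
  at the point of differentiation, every column with \<open>p > 0\<close> has derivative \<open>0\<close>. So \<open>R\<close> is the
  determinant whose columns are the functions
  \<open>U\<^sub>p(y) = \<integral>\<^sub>0\<^sup>x (t - x)\<^sup>p t\<^sup>M e\<^sup>-\<^sup>t F(ty) dt\<close> for \<open>p = m - 1, \<dots>, 1\<close> and \<open>U\<^sub>0(y) = x\<^sup>M e\<^sup>-\<^sup>x F(xy)\<close>
  (\<open>R_fun_eq_det_column_jet\<close>).

  The operator \<open>T\<^bsub>p+1\<^esub>\<close> kills \<open>U\<^sub>p\<close>: for \<open>p = 0\<close> this is the differential equation of \<open>F\<close>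
  (\<open>column_jet_P_ode\<close>), and for \<open>p > 0\<close> the operator turns the integrand into the derivative of a
  function that vanishes at \<open>0\<close> and at \<open>x\<close> (\<open>moment_shifted_kernel_ode\<close>).

  Each term of the Leibniz expansion of \<open>R\<close> is a product over the variables \<open>\<lambda>\<^sub>i\<close> of column functions
  in which every column occurs once. Applying \<open>T\<^sub>k\<close> in all variables thus kills the factor from the
  column \<open>p = k - 1\<close>. A common left multiple \<open>L\<close> of all \<open>T\<^sub>j\<close>, applied in one variable, kills
  whichever column function stands there. The delicate point is that a cofactor \<open>A\<close> in \<open>L = A T\<^sub>j\<close> may be
  singular where \<open>L\<close> is regular; clearing denominators and continuity in \<open>x\<close> and in \<open>y\<close> settle this
  (\<open>left_multiple_annihilates\<close>).
\<close>

section \<open>The regularised hypergeometric function\<close>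

text \<open>
  \<open>\<^sub>0F\<^sub>1(b + 1; z) / b!\<close>. With this normalisation differentiation only raises the index, so that no
  constants pile up in the \<open>j\<close>-th derivatives.
\<close>

definition reg0F1 :: "nat \<Rightarrow> complex \<Rightarrow> complex" where
  "reg0F1 b z = (\<Sum>k. 1 / (fact k * fact (b + k)) * z ^ k)"

lemma summable_reg0F1: "summable (\<lambda>k. 1 / (fact k * fact (b + k)) * z ^ k :: complex)"
proof (rule summable_comparison_test')
  show "summable (\<lambda>k. inverse (fact k) * norm z ^ k :: real)"
    by (rule summable_exp)
  fix k :: nat
  have "(1::real) \<le> fact (b + k)" by (rule fact_ge_1)
  then have "inverse (fact (b + k)) \<le> (1::real)" by (simp add: field_simps)
  then have "inverse (fact k) * norm z ^ k * inverse (fact (b + k)) \<le> inverse (fact k) * norm z ^ k * (1::real)"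
    by (intro mult_left_mono) auto
  then show "norm (1 / (fact k * fact (b + k)) * z ^ k) \<le> inverse (fact k) * norm z ^ k"
    by (simp add: norm_mult norm_divide norm_power field_simps)
qed

lemma hyp0F1_eq_reg0F1: "hyp0F1 (Suc b) z = fact b * reg0F1 b z"
proof -
  have "z ^ k / (pochhammer (of_nat (Suc b)) k * fact k) = fact b * (1 / (fact k * fact (b + k)) * z ^ k)" for k
    using pochhammer_product'[of "1::complex" b k]
    by (simp add: pochhammer_fact[symmetric] field_simps)
  then have "hyp0F1 (Suc b) z = (\<Sum>k. fact b * (1 / (fact k * fact (b + k)) * z ^ k))"
    unfolding hyp0F1_def by (simp only:)
  also have "\<dots> = fact b * reg0F1 b z"
    unfolding reg0F1_def by (rule suminf_mult[OF summable_reg0F1])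
  finally show ?thesis .
qed

lemma has_field_derivative_reg0F1:
  "(reg0F1 b has_field_derivative reg0F1 (Suc b) z) (at z)"
proof -
  let ?c = "\<lambda>b k. 1 / (fact k * fact (b + k)) :: complex"
  have "diffs (?c b) = ?c (Suc b)"
    by (rule ext) (simp add: diffs_def divide_simps del: of_nat_Suc)
  then show ?thesis
    using termdiffs_strong_converges_everywhere[OF summable_reg0F1, of b z]
    unfolding reg0F1_def[abs_def] by simp
qed

lemma has_field_derivative_reg0F1_chain [derivative_intros]:
  assumes "(g has_field_derivative g') (at z within S)"
  shows "((\<lambda>z. reg0F1 b (g z)) has_field_derivative reg0F1 (Suc b) (g z) * g') (at z within S)"
  by (rule DERIV_chain2[OF has_field_derivative_reg0F1 assms])

lemma continuous_on_reg0F1 [continuous_intros]: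
  assumes "continuous_on S g"
  shows "continuous_on S (\<lambda>z. reg0F1 b (g z))"
  by (rule continuous_on_compose2[OF DERIV_continuous_on[of UNIV] assms])
     (auto intro: has_field_derivative_at_within has_field_derivative_reg0F1)

lemma holomorphic_on_reg0F1 [holomorphic_intros]:
  assumes "g holomorphic_on S"
  shows "(\<lambda>z. reg0F1 b (g z)) holomorphic_on S"
proof -
  have "reg0F1 b holomorphic_on UNIV"
    using has_field_derivative_reg0F1 by (auto simp: holomorphic_on_open)
  then show ?thesis
    using assms by (auto simp: o_def intro: holomorphic_on_compose_gen[unfolded o_def])
qed

text \<open>
  Since raising the index is differentiation, this contiguous relation is the differential equation
  \<open>z u'' + (b + 1) u' - u = 0\<close>. It comes from comparing coefficients: the \<open>k\<close>-th coefficients at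
  index \<open>b\<close> and \<open>b + 1\<close> differ by the factor \<open>b + k + 1\<close>.
\<close>

lemma reg0F1_recurrence:
  "z * reg0F1 (Suc (Suc b)) z = reg0F1 b z - of_nat (Suc b) * reg0F1 (Suc b) z"
proof -
  let ?c = "\<lambda>b k. 1 / (fact k * fact (b + k)) * z ^ k :: complex"
  have "of_nat (Suc b) * ?c (Suc b) 0 = ?c b 0"
    using of_nat_neq_0[of b, where ?'a = complex] by (simp add: divide_simps del: of_nat_Suc)
  moreover have "?c b (Suc k) - of_nat (Suc b) * ?c (Suc b) (Suc k) = z * ?c (Suc (Suc b)) k" for k
    by (simp add: divide_simps del: of_nat_Suc) (simp add: algebra_simps)
  ultimately have shift: "(\<Sum>k. ?c b (Suc k) - of_nat (Suc b) * ?c (Suc b) (Suc k)) = (\<Sum>k. z * ?c (Suc (Suc b)) k)"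
    and head: "?c b 0 - of_nat (Suc b) * ?c (Suc b) 0 = 0"
    by auto
  note sums = summable_reg0F1 summable_mult[OF summable_reg0F1]
  have "z * reg0F1 (Suc (Suc b)) z = (\<Sum>k. z * ?c (Suc (Suc b)) k)"
    unfolding reg0F1_def by (rule suminf_mult[OF summable_reg0F1, symmetric])
  also have "\<dots> = (\<Sum>k. ?c b k - of_nat (Suc b) * ?c (Suc b) k)"
    unfolding shift[symmetric]
    using suminf_split_head[OF summable_diff[OF sums], of b z "of_nat (Suc b)" "Suc b" z]
    unfolding head by simp
  also have "\<dots> = reg0F1 b z - of_nat (Suc b) * reg0F1 (Suc b) z"
    unfolding reg0F1_def
    by (simp only: suminf_diff[OF sums, symmetric] suminf_mult[OF summable_reg0F1])
  finally show ?thesis .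
qed

section \<open>Incomplete moment integrals\<close>

definition moment :: "(complex \<Rightarrow> complex) \<Rightarrow> nat \<Rightarrow> complex \<Rightarrow> complex \<Rightarrow> complex" where
  "moment h b x y = contour_integral (linepath 0 x) (\<lambda>t. h t * t ^ b * reg0F1 b (t * y))"

lemma has_contour_integral_moment:
  assumes "continuous_on UNIV h"
  shows "((\<lambda>t. h t * t ^ b * reg0F1 b (t * y)) has_contour_integral moment h b x y) (linepath 0 x)"
  unfolding moment_def
  by (intro has_contour_integral_integral contour_integrable_continuous_linepath continuous_intros
      continuous_on_subset[OF assms]) auto

text \<open>
  Differentiating under the integral produces a factor \<open>t\<close> together with the raised index of
  \<open>reg0F1\<close>. Coupling the exponent of \<open>t\<close> to the index keeps the family \<open>moment h b\<close> closed under
  \<open>\<partial>/\<partial>y\<close>.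
\<close>

lemma has_field_derivative_moment_y:
  assumes h: "continuous_on UNIV h"
  shows "(moment h b x has_field_derivative moment h (Suc b) x y) (at y)"
proof -
  let ?f = "\<lambda>b y s. h (linepath 0 x s) * linepath 0 x s ^ b * reg0F1 b (linepath 0 x s * y) * x"
  have eq: "moment h b x y = integral (cbox 0 1) (?f b y)" for b y
    by (simp add: moment_def contour_integral_integral)
  have cont: "continuous_on (UNIV \<times> cbox 0 1) (\<lambda>(y, s). ?f b y s)" for b
    unfolding split_beta linepath_def
    by (intro continuous_intros continuous_on_compose2[OF h]) auto
  have "((\<lambda>y. integral (cbox 0 1) (?f b y)) has_field_derivative
      integral (cbox 0 1) (?f (Suc b) y)) (at y within UNIV)"
  proof (rule leibniz_rule_field_derivative[OF _ _ cont])
    fix y s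
    show "((\<lambda>y. ?f b y s) has_field_derivative ?f (Suc b) y s) (at y within UNIV)"
      by (auto intro!: derivative_eq_intros)
    show "?f b y integrable_on cbox 0 1"
      unfolding linepath_def
      by (intro integrable_continuous continuous_intros continuous_on_compose2[OF h]) auto
  qed auto
  then show ?thesis unfolding eq[abs_def] eq by simp
qed

lemma has_field_derivative_moment_x:
  assumes h: "h holomorphic_on UNIV"
  shows "((\<lambda>x. moment h b x y) has_field_derivative h x * x ^ b * reg0F1 b (x * y)) (at x)"
proof -
  have hol: "(\<lambda>t. h t * t ^ b * reg0F1 b (t * y)) holomorphic_on UNIV"
    by (intro holomorphic_intros h)
  obtain g where g: "\<And>t. (g has_field_derivative h t * t ^ b * reg0F1 b (t * y)) (at t)"
    using holomorphic_convex_primitive'[OF convex_UNIV open_UNIV hol] by auto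
  have "moment h b x y = g x - g 0" for x
    unfolding moment_def
    using contour_integral_unique[OF contour_integral_primitive[of UNIV g _ "linepath 0 x"]] g by simp
  then show ?thesis using g by (auto intro!: derivative_eq_intros)
qed

lemma moment_sum:
  assumes "\<And>q. q \<in> S \<Longrightarrow> continuous_on UNIV (h q)"
  shows "moment (\<lambda>t. \<Sum>q\<in>S. c q * h q t) b x y = (\<Sum>q\<in>S. c q * moment (h q) b x y)"
proof (cases "finite S")
  case True
  have "((\<lambda>t. \<Sum>q\<in>S. c q * (h q t * t ^ b * reg0F1 b (t * y))) has_contour_integral
      (\<Sum>q\<in>S. c q * moment (h q) b x y)) (linepath 0 x)"
    by (intro has_contour_integral_sum True has_contour_integral_lmul has_contour_integral_moment assms)
  then show ?thesis
    unfolding moment_def[of "\<lambda>t. \<Sum>q\<in>S. c q * h q t"]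
    by (intro contour_integral_unique) (simp add: sum_distrib_right mult.assoc)
qed (simp add: moment_def)

text \<open>
  The columns of the determinant span the same space as the integrals with kernels
  \<open>(t - x)\<^sup>p t\<^sup>M e\<^sup>-\<^sup>t\<close>. The shift by the endpoint \<open>x\<close> makes an operator \<open>Q\<close> kill
  each of these integrals with \<open>p > 0\<close>, and makes the integrand vanish at \<open>t = x\<close>.
\<close>

definition shifted_kernel :: "nat \<Rightarrow> complex \<Rightarrow> complex \<Rightarrow> complex" where
  "shifted_kernel p x t = (t - x) ^ p * exp (- t)"

lemma holomorphic_shifted_kernel: "shifted_kernel p x holomorphic_on UNIV"
  unfolding shifted_kernel_def[abs_def] by (intro holomorphic_intros)

lemma continuous_shifted_kernel: "continuous_on UNIV (shifted_kernel p x)"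
  by (intro holomorphic_on_imp_continuous_on holomorphic_shifted_kernel)

text \<open>
  The sum is extended beyond \<open>p\<close> (by vanishing binomial coefficients) so that all columns are
  combinations of one common list of integrals.
\<close>

lemma moment_shifted_kernel_binomial:
  assumes "p \<le> N"
  shows "moment (shifted_kernel p c) b x y =
    (\<Sum>q\<le>N. of_nat (p choose q) * (- c) ^ (p - q) * moment (\<lambda>t. t ^ q * exp (- t)) b x y)"
proof -
  have "(t - c) ^ p = (\<Sum>q\<le>N. of_nat (p choose q) * (- c) ^ (p - q) * t ^ q)" for t :: complex
  proof -
    have "(t + - c) ^ p = (\<Sum>q\<le>p. of_nat (p choose q) * t ^ q * (- c) ^ (p - q))"
      by (rule binomial_ring)
    also have "\<dots> = (\<Sum>q\<le>N. of_nat (p choose q) * t ^ q * (- c) ^ (p - q))"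
      using assms by (intro sum.mono_neutral_left) auto
    finally show ?thesis by (simp add: mult_ac)
  qed
  then have "shifted_kernel p c =
      (\<lambda>t. \<Sum>q\<le>N. (of_nat (p choose q) * (- c) ^ (p - q)) * (t ^ q * exp (- t)))"
    by (simp add: shifted_kernel_def fun_eq_iff sum_distrib_right mult.assoc)
  then show ?thesis
    by (simp only: moment_sum[OF continuous_on_mult[OF continuous_on_power[OF continuous_on_id]
        continuous_on_exp[OF continuous_on_minus[OF continuous_on_id]]]])
qed

text \<open>
  On the \<open>p\<close>-th integral the operator \<open>Q\<^bsub>M+p+1,M\<^esub>\<close> produces the integral of an exact derivative. With
  \<open>P = P\<^sub>M\<close> one has \<open>Q\<^bsub>N,M\<^esub> = (\<partial> - 1) P - (N - M) \<partial>\<close>, and \<open>P\<close> multiplies the integrand by \<open>t - x\<close>.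
  An integration by parts of the resulting terms then leaves a multiple of \<open>p + 1 - (N - M)\<close>, so that
  for \<open>N = M + p + 1\<close> only a boundary term remains. Its primitive \<open>\<Phi>\<close> vanishes at both ends of the
  path: at \<open>0\<close> because of the power of \<open>t\<close>, at \<open>x\<close> because of the power of \<open>t - x\<close>.
\<close>

lemma moment_shifted_kernel_ode:
  fixes M p :: nat and x y :: complex
  defines "F \<equiv> \<lambda>j. moment (shifted_kernel p x) (M + j) x y"
  shows "x * F 0 - (x + of_nat (M + Suc p) + 1) * F 1 + (of_nat M - y + 2) * F 2 + y * F 3 = 0"
proof -
  define \<Phi> where "\<Phi> t = - ((t - x) ^ Suc p * t ^ Suc M * exp (- t) * reg0F1 (Suc M) (t * y))" for t
  let ?f = "\<lambda>j t. shifted_kernel p x t * t ^ (M + j) * reg0F1 (M + j) (t * y)"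
  let ?g = "\<lambda>t. x * ?f 0 t - (x + of_nat (M + Suc p) + 1) * ?f 1 t + (of_nat M - y + 2) * ?f 2 t + y * ?f 3 t"
  have der: "(\<Phi> has_field_derivative ?g t) (at t)" for t
  proof -
    define E where "E j = reg0F1 (M + j) (t * y)" for j
    have E2: "t * y * E 2 = E 0 - (of_nat M + 1) * E 1"
      using reg0F1_recurrence[of "t * y" M] by (simp add: E_def numeral_2_eq_2 algebra_simps)
    have E3: "t * y * E 3 = E 1 - (of_nat M + 2) * E 2"
      using reg0F1_recurrence[of "t * y" "Suc M"]
      by (simp add: E_def numeral_2_eq_2 numeral_3_eq_3 algebra_simps)
    let ?w = "(t - x) ^ p * t ^ M * exp (- t)"
    have D: "(\<Phi> has_field_derivative
        ?w * ((t - x) * t * E 1 - of_nat (Suc p) * t * E 1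
          - (t - x) * (of_nat (Suc M) * E 1 + t * y * E 2))) (at t)"
      unfolding \<Phi>_def E_def
      by (rule derivative_eq_intros refl)+ (simp add: algebra_simps numeral_2_eq_2)
    have g: "?g t = ?w * (x * E 0 - (x + of_nat (M + Suc p) + 1) * (t * E 1) +
        (of_nat M - y + 2) * t^2 * E 2 + t^2 * (t * y * E 3))"
      by (simp add: shifted_kernel_def E_def power_add algebra_simps numeral_3_eq_3 power2_eq_square)
    have "x * E 0 - (x + of_nat (M + Suc p) + 1) * (t * E 1) +
        (of_nat M - y + 2) * t^2 * E 2 + t^2 * (t * y * E 3) =
        x * E 0 - (x + of_nat (M + Suc p) + 1) * (t * E 1) + t^2 * E 1 - t * (t * y * E 2)"
      unfolding E3 by (simp add: algebra_simps power2_eq_square)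
    also have "\<dots> = (t - x) * t * E 1 - of_nat (Suc p) * t * E 1
          - (t - x) * (of_nat (Suc M) * E 1 + t * y * E 2)"
      unfolding E2 by (simp add: algebra_simps power2_eq_square)
    finally show ?thesis using D unfolding g by simp
  qed
  have "(?g has_contour_integral \<Phi> x - \<Phi> 0) (linepath 0 x)"
    using contour_integral_primitive[of UNIV \<Phi> ?g "linepath 0 x"] der by simp
  moreover have "(?g has_contour_integral
      x * F 0 - (x + of_nat (M + Suc p) + 1) * F 1 + (of_nat M - y + 2) * F 2 + y * F 3) (linepath 0 x)"
    unfolding F_def
    by (intro has_contour_integral_add has_contour_integral_diff has_contour_integral_lmul
        has_contour_integral_moment continuous_shifted_kernel)
  ultimately have "x * F 0 - (x + of_nat (M + Suc p) + 1) * F 1 + (of_nat M - y + 2) * F 2 + y * F 3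
      = \<Phi> x - \<Phi> 0"
    by (rule contour_integral_unique[symmetric, THEN trans, OF _ contour_integral_unique, rotated])
  then show ?thesis by (simp add: \<Phi>_def)
qed

text \<open>
  The \<open>j\<close>-th \<open>y\<close>-derivative of the \<open>p\<close>-th column function. The columns \<open>p > 0\<close> are the shifted
  integrals; the column \<open>p = 0\<close> is the \<open>x\<close>-derivative of the integral with kernel \<open>t\<^sup>M e\<^sup>-\<^sup>t\<close>. The factor \<open>M!\<close>
  undoes the normalisation of \<open>reg0F1\<close>.
\<close>

definition column_jet :: "nat \<Rightarrow> nat \<Rightarrow> nat \<Rightarrow> complex \<Rightarrow> complex \<Rightarrow> complex" where
  "column_jet M p j x y = fact M *
     (if p = 0 then exp (- x) * x ^ (M + j) * reg0F1 (M + j) (x * y)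
      else moment (shifted_kernel p x) (M + j) x y)"

lemma has_field_derivative_column_jet:
  "(column_jet M p j x has_field_derivative column_jet M p (Suc j) x y) (at y)"
proof (cases "p = 0")
  case True
  then show ?thesis
    unfolding column_jet_def[abs_def] by (auto intro!: derivative_eq_intros)
next
  case False
  then show ?thesis
    unfolding column_jet_def[abs_def]
    using has_field_derivative_moment_y[OF continuous_shifted_kernel, of p x "M + j" x y]
    by (auto intro!: DERIV_cmult)
qed

text \<open>
  For \<open>p > 0\<close> the endpoint \<open>x\<close> also occurs in the kernel; the binomial expansion moves it outside the
  integral.
\<close>

lemma continuous_column_jet_x: "continuous_on UNIV (\<lambda>x. column_jet M p j x y)"
proof (cases "p = 0")
  case True
  then show ?thesis unfolding column_jet_def by (auto intro!: continuous_intros)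
next
  case False
  have "continuous_on UNIV (\<lambda>x. moment (\<lambda>t. t ^ q * exp (- t)) (M + j) x y)" for q
    by (rule DERIV_continuous_on, rule has_field_derivative_at_within,
        rule has_field_derivative_moment_x) (intro holomorphic_intros)
  then show ?thesis
    using False unfolding column_jet_def moment_shifted_kernel_binomial[OF order_refl]
    by (auto intro!: continuous_intros)
qed

lemma column_jet_P_ode:
  "- x * column_jet M 0 0 x y + of_nat (Suc M) * column_jet M 0 1 x y + y * column_jet M 0 2 x y = 0"
proof -
  have "- x * column_jet M 0 0 x y + of_nat (Suc M) * column_jet M 0 1 x y + y * column_jet M 0 2 x y =
      fact M * exp (- x) * x ^ Suc M *
      (x * y * reg0F1 (Suc (Suc M)) (x * y) - (reg0F1 M (x * y) - of_nat (Suc M) * reg0F1 (Suc M) (x * y)))"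
    by (simp add: column_jet_def algebra_simps numeral_2_eq_2)
  then show ?thesis by (simp only: reg0F1_recurrence) simp
qed

lemma column_jet_Q_ode:
  assumes "0 < p"
  shows "x * column_jet M p 0 x y - (x + of_nat (M + Suc p) + 1) * column_jet M p 1 x y
     + (of_nat M - y + 2) * column_jet M p 2 x y + y * column_jet M p 3 x y = 0"
proof -
  have "x * column_jet M p 0 x y - (x + of_nat (M + Suc p) + 1) * column_jet M p 1 x y
     + (of_nat M - y + 2) * column_jet M p 2 x y + y * column_jet M p 3 x y =
    fact M * (let F = \<lambda>j. moment (shifted_kernel p x) (M + j) x y in
      x * F 0 - (x + of_nat (M + Suc p) + 1) * F 1 + (of_nat M - y + 2) * F 2 + y * F 3)"
    using assms by (simp add: column_jet_def Let_def algebra_simps)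
  also have "\<dots> = 0"
    unfolding Let_def moment_shifted_kernel_ode by simp
  finally show ?thesis .
qed

section \<open>The determinant as a sum of products of column functions\<close>

lemma det_mat_Leibniz:
  "Determinant.det (Matrix.mat m m (\<lambda>(i, j). a i j)) =
    (\<Sum>p | p permutes {0..<m}. signof p * (\<Prod>i = 0..<m. a i (p i)))"
proof -
  have "(\<Prod>i = 0..<m. Matrix.mat m m (\<lambda>(i, j). a i j) $$ (i, p i)) = (\<Prod>i = 0..<m. a i (p i))"
    if "p permutes {0..<m}" for p
    using permutes_in_image[OF that] by (intro prod.cong) auto
  then show ?thesis by (subst det_def'[of _ m]) (auto intro!: sum.cong)
qed

lemma has_field_derivative_det_single_column:
  fixes a :: "nat \<Rightarrow> nat \<Rightarrow> complex \<Rightarrow> complex"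
  assumes c: "c < m"
    and a: "\<And>i j. i < m \<Longrightarrow> j < m \<Longrightarrow> (a i j has_field_derivative (if j = c then b i else 0)) (at x0)"
  shows "((\<lambda>x. Determinant.det (Matrix.mat m m (\<lambda>(i, j). a i j x))) has_field_derivative
    Determinant.det (Matrix.mat m m (\<lambda>(i, j). if j = c then b i else a i j x0))) (at x0)"
proof -
  have col: "Determinant.det (Matrix.mat m m (\<lambda>(i, j). f i j)) =
    (\<Sum>p | p permutes {0..<m}. signof p * (\<Prod>j<m. f (p j) j))" for f :: "nat \<Rightarrow> nat \<Rightarrow> complex"
  proof -
    have "(\<Prod>j<m. Matrix.mat m m (\<lambda>(i, j). f i j) $$ (p j, j)) = (\<Prod>j<m. f (p j) j)"
      if "p permutes {0..<m}" for p
      using permutes_in_image[OF that] by (intro prod.cong) auto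
    then show ?thesis by (subst det_col[of _ m]) (auto intro!: sum.cong)
  qed
  have "((\<lambda>x. \<Prod>j<m. a (p j) j x) has_field_derivative
      (\<Prod>j<m. if j = c then b (p j) else a (p j) j x0)) (at x0)"
    if "p permutes {0..<m}" for p
  proof -
    have in_range: "p j < m" if "j < m" for j
      using permutes_in_image[OF \<open>p permutes _\<close>] that by auto
    have "((\<lambda>x. \<Prod>j<m. a (p j) j x) has_field_derivative
        (\<Sum>j<m. (if j = c then b (p j) else 0) * (\<Prod>k\<in>{..<m} - {j}. a (p k) k x0))) (at x0)"
      using in_range by (intro has_field_derivative_prod a) auto
    also have "(\<Sum>j<m. (if j = c then b (p j) else 0) * (\<Prod>k\<in>{..<m} - {j}. a (p k) k x0)) =
        (\<Sum>j<m. if j = c then b (p j) * (\<Prod>k\<in>{..<m} - {j}. a (p k) k x0) else 0)"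
      by (intro sum.cong) auto
    also have "\<dots> = b (p c) * (\<Prod>k\<in>{..<m} - {c}. a (p k) k x0)"
      using c by simp
    also have "\<dots> = (\<Prod>j<m. if j = c then b (p j) else a (p j) j x0)"
      using c by (subst (2) prod.remove[of _ c]) (auto intro!: prod.cong)
    finally show ?thesis .
  qed
  then show ?thesis
    unfolding col by (intro DERIV_sum DERIV_cmult) auto
qed

lemma det_unitriangular_columns:
  fixes a :: "nat \<Rightarrow> nat \<Rightarrow> 'a :: comm_ring_1"
  assumes "\<And>j. j < m \<Longrightarrow> c j j = 1" and "\<And>k j. k < j \<Longrightarrow> j < m \<Longrightarrow> c k j = 0"
  shows "Determinant.det (Matrix.mat m m (\<lambda>(i, j). \<Sum>k<m. a i k * c k j)) =
    Determinant.det (Matrix.mat m m (\<lambda>(i, j). a i j))"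
proof -
  let ?A = "Matrix.mat m m (\<lambda>(i, j). a i j)" and ?C = "Matrix.mat m m (\<lambda>(k, j). c k j)"
  have "Determinant.det ?C = prod_list (diag_mat ?C)"
    using assms by (intro det_lower_triangular[of m]) auto
  also have "\<dots> = 1"
    using assms by (simp add: prod_list_diag_prod)
  finally have "Determinant.det (?A * ?C) = Determinant.det ?A"
    by (subst det_mult[of _ m]) auto
  moreover have "?A * ?C = Matrix.mat m m (\<lambda>(i, j). \<Sum>k<m. a i k * c k j)"
    by (rule eq_matI) (auto simp: scalar_prod_def atLeast0LessThan)
  ultimately show ?thesis by simp
qed

lemma H_int_eq_moment:
  "H_int k (Suc M) x y = fact M * moment (\<lambda>t. t ^ (k - M) * exp (- t)) M x y" if "M \<le> k"
proof -
  have eq: "t ^ k * exp (- t) * hyp0F1 (Suc M) (t * y) =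
      fact M * (t ^ (k - M) * exp (- t) * t ^ M * reg0F1 M (t * y))" for t
    using that by (simp add: hyp0F1_eq_reg0F1 power_add[symmetric] mult_ac)
  have "continuous_on UNIV (\<lambda>t::complex. t ^ (k - M) * exp (- t))"
    by (intro continuous_intros)
  then show ?thesis
    unfolding H_int_def eq
    by (intro contour_integral_unique has_contour_integral_lmul has_contour_integral_moment)
qed

text \<open>
  Expanding \<open>(t - c)\<^sup>p\<close> is a unitriangular column operation, so the determinant of the integrals with
  kernels \<open>t\<^sup>p\<close> is unchanged when each \<open>t\<^sup>p\<close> becomes \<open>(t - c)\<^sup>p\<close>. Column \<open>j\<close> carries \<open>p = m - 1 - j\<close>.
  The constant \<open>c\<close> stays independent of \<open>x\<close>, so the identity can be differentiated in \<open>x\<close>.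
\<close>

lemma det_H_int_eq_det_shifted:
  assumes "m \<le> n"
  shows "Determinant.det (Matrix.mat m m (\<lambda>(i, j). H_int (n - Suc j) (n - m + 1) x (l (Suc i)))) =
    Determinant.det (Matrix.mat m m (\<lambda>(i, j).
      fact (n - m) * moment (shifted_kernel (m - Suc j) c) (n - m) x (l (Suc i))))"
proof -
  define h where "h q y = fact (n - m) * moment (\<lambda>t. t ^ q * exp (- t)) (n - m) x y" for q y
  define C where "C k j = of_nat ((m - Suc j) choose (m - Suc k)) * (- c) ^ ((m - Suc j) - (m - Suc k))" for k j
  have H: "H_int (n - Suc j) (n - m + 1) x y = h (m - Suc j) y" if "j < m" for j y
    using that assms H_int_eq_moment[of "n - m" "n - Suc j" x y] by (simp add: h_def)
  have S: "fact (n - m) * moment (shifted_kernel (m - Suc j) c) (n - m) x y =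
      (\<Sum>k<m. h (m - Suc k) y * C k j)" if "j < m" for j y
  proof -
    have "{..m - Suc 0} = {..<m}" using that by auto
    then have "fact (n - m) * moment (shifted_kernel (m - Suc j) c) (n - m) x y =
      (\<Sum>q<m. h q y * (of_nat ((m - Suc j) choose q) * (- c) ^ ((m - Suc j) - q)))"
      using moment_shifted_kernel_binomial[of "m - Suc j" "m - Suc 0" c "n - m" x y]
      by (simp add: h_def sum_distrib_left mult_ac)
    also have "\<dots> = (\<Sum>k<m. h (m - Suc k) y * C k j)"
      unfolding C_def by (rule sum.nat_diff_reindex[symmetric])
    finally show ?thesis .
  qed
  have "Determinant.det (Matrix.mat m m (\<lambda>(i, j). H_int (n - Suc j) (n - m + 1) x (l (Suc i)))) =
      Determinant.det (Matrix.mat m m (\<lambda>(i, j). h (m - Suc j) (l (Suc i))))"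
    by (intro arg_cong[of _ _ Determinant.det] cong_mat) (auto simp: H simp del: One_nat_def)
  also have "\<dots> = Determinant.det (Matrix.mat m m (\<lambda>(i, j). \<Sum>k<m. h (m - Suc k) (l (Suc i)) * C k j))"
    by (rule det_unitriangular_columns[symmetric]) (auto simp: C_def)
  also have "\<dots> = Determinant.det (Matrix.mat m m (\<lambda>(i, j).
      fact (n - m) * moment (shifted_kernel (m - Suc j) c) (n - m) x (l (Suc i))))"
    by (intro arg_cong[of _ _ Determinant.det] cong_mat) (auto simp: S)
  finally show ?thesis .
qed

text \<open>
  At the point \<open>x\<close> of differentiation choose \<open>c = x\<close>. By the fundamental theorem of calculus the
  derivative of a column with \<open>p > 0\<close> contains the factor \<open>(x - c)\<^sup>p = 0\<close>, so of the \<open>m\<close> terms of the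
  product rule only the one for the last column \<open>p = 0\<close> survives.
\<close>

lemma R_fun_eq_det_column_jet:
  assumes "1 \<le> m" and "m \<le> n"
  shows "R_fun n m x l =
    Determinant.det (Matrix.mat m m (\<lambda>(i, j). column_jet (n - m) (m - Suc j) 0 x (l (Suc i))))"
proof -
  define a where "a i j z = fact (n - m) * moment (shifted_kernel (m - Suc j) x) (n - m) z (l (Suc i))"
    for i j z
  define b where "b i = fact (n - m) * (exp (- x) * x ^ (n - m) * reg0F1 (n - m) (x * l (Suc i)))" for i
  have der: "(a i j has_field_derivative (if j = m - 1 then b i else 0)) (at x)" if "j < m" for i j
  proof -
    have "(a i j has_field_derivative fact (n - m) *
        (shifted_kernel (m - Suc j) x x * x ^ (n - m) * reg0F1 (n - m) (x * l (Suc i)))) (at x)"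
      unfolding a_def by (intro DERIV_cmult has_field_derivative_moment_x holomorphic_shifted_kernel)
    moreover have "m - Suc j = 0 \<longleftrightarrow> j = m - 1" using that by auto
    ultimately show ?thesis
      by (auto simp: shifted_kernel_def b_def power_0_left split: if_splits)
  qed
  have "R_fun n m x l = deriv (\<lambda>z. Determinant.det (Matrix.mat m m (\<lambda>(i, j). a i j z))) x"
    unfolding R_fun_def a_def by (rule arg_cong[of _ _ "\<lambda>f. deriv f x"])
      (rule ext, rule det_H_int_eq_det_shifted[OF assms(2)])
  also have "\<dots> = Determinant.det (Matrix.mat m m (\<lambda>(i, j). if j = m - 1 then b i else a i j x))"
    using assms der by (intro DERIV_imp_deriv has_field_derivative_det_single_column) auto
  also have "\<dots> = Determinant.det (Matrix.mat m m (\<lambda>(i, j). column_jet (n - m) (m - Suc j) 0 x (l (Suc i))))"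
    by (intro arg_cong[of _ _ Determinant.det] cong_mat) (auto simp: a_def b_def column_jet_def)
  finally show ?thesis .
qed

lemma R_fun_eq_sum_prod:
  assumes "1 \<le> m" and "m \<le> n"
  shows "R_fun n m x = (\<lambda>l. \<Sum>p | p permutes {0..<m}. signof p *
    (\<Prod>i\<in>{1..m}. column_jet (n - m) (m - Suc (p (i - 1))) 0 x (l i)))"
proof
  fix l
  have "(\<Prod>i = 0..<m. column_jet (n - m) (m - Suc (p i)) 0 x (l (Suc i))) =
      (\<Prod>i\<in>{1..m}. column_jet (n - m) (m - Suc (p (i - 1))) 0 x (l i))" for p
    by (rule prod.reindex_bij_witness[of _ "\<lambda>i. i - 1" Suc]) auto
  note reindex = this
  show "R_fun n m x l = (\<Sum>p | p permutes {0..<m}. signof p *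
    (\<Prod>i\<in>{1..m}. column_jet (n - m) (m - Suc (p (i - 1))) 0 x (l i)))"
    by (simp only: R_fun_eq_det_column_jet[OF assms] det_mat_Leibniz reindex)
qed

section \<open>Operators acting on sums of products\<close>

text \<open>
  The one-variable counterpart of \<open>dop_act\<close>, acting on a single factor of a product of functions of
  separate variables.
\<close>

definition dop_apply :: "dop \<Rightarrow> complex \<Rightarrow> (complex \<Rightarrow> complex) \<Rightarrow> complex \<Rightarrow> complex" where
  "dop_apply L x g y = (\<Sum>j\<le>degree L. rf_eval (coeff L j) x y * (deriv ^^ j) g y)"

lemma partial_deriv_funpow_sum:
  assumes a: "\<And>s l z. a s (l(k := z)) = a s l"
    and g: "\<And>s. s \<in> S \<Longrightarrow> g s holomorphic_on UNIV"
  shows "(partial_deriv k ^^ j) (\<lambda>l. \<Sum>s\<in>S. a s l * g s (l k)) =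
    (\<lambda>l. \<Sum>s\<in>S. a s l * (deriv ^^ j) (g s) (l k))"
proof (induction j)
  case (Suc j)
  have hol: "(deriv ^^ j) (g s) holomorphic_on UNIV" if "s \<in> S" for s
    by (rule holomorphic_higher_deriv[OF g[OF that] open_UNIV])
  have "((\<lambda>z. \<Sum>s\<in>S. a s l * (deriv ^^ j) (g s) z) has_field_derivative
      (\<Sum>s\<in>S. a s l * (deriv ^^ Suc j) (g s) y)) (at y)" for l y
    using hol by (intro DERIV_sum DERIV_cmult) (auto intro!: holomorphic_derivI[of _ UNIV])
  then have "partial_deriv k (\<lambda>l. \<Sum>s\<in>S. a s l * (deriv ^^ j) (g s) (l k)) l =
      (\<Sum>s\<in>S. a s l * (deriv ^^ Suc j) (g s) (l k))" for l
    unfolding partial_deriv_def by (simp add: a DERIV_imp_deriv)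
  then show ?case
    unfolding funpow.simps o_def[of "partial_deriv k"] Suc.IH by blast
qed auto

lemma dop_act_sum:
  assumes a: "\<And>s l z. a s (l(k := z)) = a s l"
    and g: "\<And>s. s \<in> S \<Longrightarrow> g s holomorphic_on UNIV"
  shows "dop_act L x k (\<lambda>l. \<Sum>s\<in>S. a s l * g s (l k)) = (\<lambda>l. \<Sum>s\<in>S. a s l * dop_apply L x (g s) (l k))"
proof
  fix l
  have "dop_act L x k (\<lambda>l. \<Sum>s\<in>S. a s l * g s (l k)) l =
      (\<Sum>j\<le>degree L. \<Sum>s\<in>S. rf_eval (coeff L j) x (l k) * (a s l * (deriv ^^ j) (g s) (l k)))"
    unfolding dop_act_def by (simp only: partial_deriv_funpow_sum[OF a g] sum_distrib_left)
  also have "\<dots> = (\<Sum>s\<in>S. a s l * dop_apply L x (g s) (l k))"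
    by (subst sum.swap) (simp add: dop_apply_def sum_distrib_left mult_ac)
  finally show "dop_act L x k (\<lambda>l. \<Sum>s\<in>S. a s l * g s (l k)) l = (\<Sum>s\<in>S. a s l * dop_apply L x (g s) (l k))" .
qed

lemma dop_act_sum_prod:
  fixes c :: "'s \<Rightarrow> complex" and g :: "'s \<Rightarrow> nat \<Rightarrow> complex \<Rightarrow> complex"
  assumes "finite I" and "k \<in> I" and "\<And>s. s \<in> S \<Longrightarrow> g s k holomorphic_on UNIV"
  shows "dop_act L x k (\<lambda>l. \<Sum>s\<in>S. c s * (\<Prod>i\<in>I. g s i (l i))) =
    (\<lambda>l. \<Sum>s\<in>S. c s * (\<Prod>i\<in>I. (if i = k then dop_apply L x (g s i) else g s i) (l i)))"
proof -
  let ?a = "\<lambda>s l. c s * (\<Prod>i\<in>I - {k}. g s i (l i))"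
  have split: "c s * (\<Prod>i\<in>I. f i (l i)) = c s * (\<Prod>i\<in>I - {k}. f i (l i)) * f k (l k)"
    for s l and f :: "nat \<Rightarrow> complex \<Rightarrow> complex"
    by (simp add: prod.remove[OF assms(1,2)])
  have drop: "(\<Prod>i\<in>I - {k}. (if i = k then dop_apply L x (g s i) else g s i) (l i)) =
      (\<Prod>i\<in>I - {k}. g s i (l i))" for s l
    by (intro prod.cong) auto
  have "dop_act L x k (\<lambda>l. \<Sum>s\<in>S. ?a s l * g s k (l k)) =
      (\<lambda>l. \<Sum>s\<in>S. ?a s l * dop_apply L x (g s k) (l k))"
    by (rule dop_act_sum) (auto intro!: prod.cong assms)
  moreover have "c s * (\<Prod>i\<in>I. (if i = k then dop_apply L x (g s i) else g s i) (l i)) =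
      ?a s l * dop_apply L x (g s k) (l k)" for s l
    using split[of s "\<lambda>i. if i = k then dop_apply L x (g s i) else g s i" l] drop[of s l] by simp
  moreover have "c s * (\<Prod>i\<in>I. g s i (l i)) = ?a s l * g s k (l k)" for s l
    by (rule split)
  ultimately show ?thesis by (simp only:)
qed

text \<open>
  Each operator meets a factor in its own variable that no earlier one has touched, so holomorphy of
  the original factors suffices at every step.
\<close>

lemma foldr_dop_act_sum_prod:
  fixes c :: "'s \<Rightarrow> complex" and g :: "'s \<Rightarrow> nat \<Rightarrow> complex \<Rightarrow> complex"
  assumes "finite I" and "\<And>s i. s \<in> S \<Longrightarrow> i \<in> I \<Longrightarrow> g s i holomorphic_on UNIV"
    and "distinct ks" and "set ks \<subseteq> I"
  shows "foldr (dop_act L x) ks (\<lambda>l. \<Sum>s\<in>S. c s * (\<Prod>i\<in>I. g s i (l i))) =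
    (\<lambda>l. \<Sum>s\<in>S. c s * (\<Prod>i\<in>I. (if i \<in> set ks then dop_apply L x (g s i) else g s i) (l i)))"
  using assms(3,4)
proof (induction ks)
  case (Cons k ks)
  let ?g = "\<lambda>s i. if i \<in> set ks then dop_apply L x (g s i) else g s i"
  have "foldr (dop_act L x) (k # ks) (\<lambda>l. \<Sum>s\<in>S. c s * (\<Prod>i\<in>I. g s i (l i))) =
      dop_act L x k (\<lambda>l. \<Sum>s\<in>S. c s * (\<Prod>i\<in>I. ?g s i (l i)))"
    using Cons by simp
  also have "\<dots> = (\<lambda>l. \<Sum>s\<in>S. c s * (\<Prod>i\<in>I. (if i = k then dop_apply L x (?g s i) else ?g s i) (l i)))"
    using Cons.prems assms(1,2) by (intro dop_act_sum_prod) auto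
  also have "\<dots> = (\<lambda>l. \<Sum>s\<in>S. c s * (\<Prod>i\<in>I. (if i \<in> set (k # ks) then dop_apply L x (g s i) else g s i) (l i)))"
    using Cons.prems by (intro ext sum.cong arg_cong2[of _ _ _ _ "(*)"] prod.cong) auto
  finally show ?case .
qed simp

section \<open>Rational functions and their denominators\<close>

lemma poly_xy_pCons [simp]: "poly_xy (pCons a p) x y = poly a x + y * poly_xy p x y"
  by (simp add: poly_xy_def)

lemma poly_xy_add: "poly_xy (p + q) x y = poly_xy p x y + poly_xy q x y"
  by (simp add: poly_xy_def)

lemma poly_xy_sum: "poly_xy (\<Sum>i\<in>S. p i) x y = (\<Sum>i\<in>S. poly_xy (p i) x y)"
  by (induction S rule: infinite_finite_induct) (auto simp: poly_xy_add)

lemma poly_xy_eq_poly: "poly_xy p x y = poly (map_poly (\<lambda>c. poly c x) p) y"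
  by (induction p) (auto simp: map_poly_pCons)

lemma has_field_derivative_poly_xy:
  "((\<lambda>y. poly_xy p x y) has_field_derivative poly_xy (pderiv p) x y) (at y)"
  by (induction p) (auto simp: pderiv_pCons poly_xy_add intro!: derivative_eq_intros)

lemma Fract_add_same: "d \<noteq> 0 \<Longrightarrow> Fract a d + Fract b d = Fract (a + b) d"
  for a b d :: "'a :: idom"
  by (simp add: eq_fract algebra_simps)

lemma Fract_sum_same: "d \<noteq> 0 \<Longrightarrow> (\<Sum>i\<in>S. Fract (a i) d) = Fract (\<Sum>i\<in>S. a i) d"
  for d :: "'a :: idom"
  by (induction S rule: infinite_finite_induct) (auto simp: Fract_add_same Zero_fract_def eq_fract distrib_right)

text \<open>
  The property \<open>P\<close> covers two uses: denominators that are merely nonzero, and denominators that do not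
  vanish at a given point.
\<close>

lemma common_denominator:
  fixes r :: "'i \<Rightarrow> 'a :: idom fract"
  assumes "finite J" and "\<And>j. j \<in> J \<Longrightarrow> \<exists>p q. r j = Fract p q \<and> P q"
    and P: "P 1" "\<And>a b. P a \<Longrightarrow> P b \<Longrightarrow> P (a * b)" "\<And>a. P a \<Longrightarrow> a \<noteq> 0"
  obtains p q where "P q" and "\<And>j. j \<in> J \<Longrightarrow> r j = Fract (p j) q"
proof -
  from assms(1,2) have "\<exists>p q. P q \<and> (\<forall>j\<in>J. r j = Fract (p j) q)"
  proof (induction J)
    case (insert i J)
    obtain p q where q: "P q" "\<forall>j\<in>J. r j = Fract (p j) q" using insert by blast
    obtain p' q' where q': "r i = Fract p' q'" "P q'" using insert.prems[of i] by blast
    have "\<forall>j\<in>insert i J. r j = Fract (if j = i then p' * q else p j * q') (q * q')"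
      using q q' P(3) by (auto simp: eq_fract)
    moreover have "P (q * q')" using P(2) q(1) q'(2) .
    ultimately show ?case
      by (intro exI[of _ "\<lambda>j. if j = i then p' * q else p j * q'"] exI[of _ "q * q'"] conjI)
  qed (use P(1) in auto)
  then show ?thesis using that by blast
qed

lemma continuous_zero_off_finite:
  fixes f :: "complex \<Rightarrow> complex"
  assumes "continuous_on UNIV f" and "finite Z" and "\<And>z. z \<notin> Z \<Longrightarrow> f z = 0"
  shows "f z = 0"
proof -
  have "closure (- Z) = UNIV"
    using empty_interior_finite[OF assms(2)] by (simp add: closure_complement)
  then show ?thesis
    using continuous_constant_on_closure[of "- Z" f 0 z] assms by (auto intro: continuous_on_subset)
qed

text \<open>
  A polynomial \<open>d \<noteq> 0\<close> may vanish on a whole line \<open>x = x\<^sub>0\<close>, so continuity in \<open>y\<close> alone does not remove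
  it. But its leading coefficient in \<open>y\<close> is a nonzero polynomial in \<open>x\<close> with finitely many zeros; for all other \<open>x\<close> there are
  finitely many exceptional \<open>y\<close>. Separate continuity, used in \<open>y\<close> and then in \<open>x\<close>, is enough.
\<close>

lemma cancel_poly_xy:
  assumes d: "d \<noteq> 0" and zero: "\<And>x y. poly_xy d x y * S x y = 0"
    and cx: "\<And>y. continuous_on UNIV (\<lambda>x. S x y)" and cy: "\<And>x. continuous_on UNIV (S x)"
  shows "S x y = 0"
proof (rule continuous_zero_off_finite[OF cx])
  show "finite {x. poly (lead_coeff d) x = 0}"
    using d by (intro poly_roots_finite) simp
  fix x assume "x \<notin> {x. poly (lead_coeff d) x = 0}"
  then have "map_poly (\<lambda>c. poly c x) d \<noteq> 0"
    by (auto simp: poly_eq_iff coeff_map_poly)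
  then have "finite {y. poly_xy d x y = 0}"
    unfolding poly_xy_eq_poly by (rule poly_roots_finite)
  then show "S x y = 0"
    by (rule continuous_zero_off_finite[OF cy]) (use zero in auto)
qed

section \<open>Operators annihilating a family of entire functions\<close>

text \<open>
  \<open>G j\<close> plays the role of the \<open>j\<close>-th \<open>y\<close>-derivative of a function of \<open>(x, y)\<close>. The coefficients are required
  to be polynomials; then the equation makes sense at every point and can be
  differentiated without exceptional points.
\<close>

definition annihilates_jet :: "dop \<Rightarrow> (nat \<Rightarrow> complex \<Rightarrow> complex \<Rightarrow> complex) \<Rightarrow> bool" where
  "annihilates_jet B G \<longleftrightarrow> (\<exists>b. (\<forall>j. coeff B j = Fract (b j) 1) \<and>
     (\<forall>x y. (\<Sum>j\<le>degree B. poly_xy (b j) x y * G j x y) = 0))"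

lemma annihilates_jetE:
  assumes "annihilates_jet B G"
  obtains b where "\<And>j. coeff B j = Fract (b j) 1" and "\<And>j. degree B < j \<Longrightarrow> b j = 0"
    and "\<And>N x y. degree B \<le> N \<Longrightarrow> (\<Sum>j\<le>N. poly_xy (b j) x y * G j x y) = 0"
proof -
  obtain b where b: "\<And>j. coeff B j = Fract (b j) 1"
      "\<And>x y. (\<Sum>j\<le>degree B. poly_xy (b j) x y * G j x y) = 0"
    using assms unfolding annihilates_jet_def by blast
  have b0: "b j = 0" if "degree B < j" for j
    using b(1)[of j] coeff_eq_0[OF that] by (simp add: Zero_fract_def eq_fract)
  have "(\<Sum>j\<le>N. poly_xy (b j) x y * G j x y) = 0" if "degree B \<le> N" for N x y
    using b(2)[of x y] that b0
    by (subst sum.mono_neutral_right[of _ "{..degree B}"]) auto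
  with b(1) b0 show ?thesis using that by blast
qed

lemma annihilates_jetI:
  assumes "\<And>j. coeff B j = Fract (b j) 1" and "degree B \<le> N"
    and "\<And>x y. (\<Sum>j\<le>N. poly_xy (b j) x y * G j x y) = 0"
  shows "annihilates_jet B G"
proof -
  have b0: "b j = 0" if "degree B < j" for j
    using assms(1)[of j] coeff_eq_0[OF that] by (simp add: Zero_fract_def eq_fract)
  have "(\<Sum>j\<le>degree B. poly_xy (b j) x y * G j x y) = 0" for x y
    using assms(3)[of x y] assms(2) b0
    by (subst (asm) sum.mono_neutral_right[of _ "{..degree B}"]) auto
  with assms(1) show ?thesis unfolding annihilates_jet_def by blast
qed

lemma annihilates_jet_D_mult:
  assumes B: "annihilates_jet B G"
    and G: "\<And>j x y. (G j x has_field_derivative G (Suc j) x y) (at y)"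
  shows "annihilates_jet (D_mult B) G"
proof -
  obtain b where b: "\<And>j. coeff B j = Fract (b j) 1" "\<And>j. degree B < j \<Longrightarrow> b j = 0"
      "\<And>N x y. degree B \<le> N \<Longrightarrow> (\<Sum>j\<le>N. poly_xy (b j) x y * G j x y) = 0"
    using annihilates_jetE[OF B] by metis
  let ?N = "degree B"
  \<comment> \<open>The coefficients of \<open>(\<partial>/\<partial>y) B\<close>: the shifted ones of \<open>B\<close> plus their derivatives.\<close>
  let ?b = "\<lambda>j. (case j of 0 \<Rightarrow> 0 | Suc i \<Rightarrow> b i) + pderiv (b j)"
  show ?thesis
  proof (rule annihilates_jetI[where b = ?b and N = "Suc ?N"])
    show "coeff (D_mult B) j = Fract (?b j) 1" for j
      by (cases j)
        (simp_all add: D_mult_def coeff_map_poly b(1) rf_pderiv_Fract Zero_fract_def)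
    have "degree (map_poly rf_pderiv B) \<le> Suc ?N"
      by (intro degree_le) (auto simp: coeff_map_poly coeff_eq_0)
    then show "degree (D_mult B) \<le> Suc ?N"
      unfolding D_mult_def by (intro degree_add_le degree_pCons_le)
    fix x y
    have "((\<lambda>y. \<Sum>j\<le>?N. poly_xy (b j) x y * G j x y) has_field_derivative
        (\<Sum>j\<le>?N. poly_xy (b j) x y * G (Suc j) x y + poly_xy (pderiv (b j)) x y * G j x y)) (at y)"
      by (intro DERIV_sum DERIV_mult' has_field_derivative_poly_xy G)
    moreover have "(\<lambda>y. \<Sum>j\<le>?N. poly_xy (b j) x y * G j x y) = (\<lambda>_. 0)"
      using b(3)[OF order_refl] by blast
    ultimately have "((\<lambda>_. 0) has_field_derivative
        (\<Sum>j\<le>?N. poly_xy (b j) x y * G (Suc j) x y + poly_xy (pderiv (b j)) x y * G j x y)) (at y)"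
      by (simp only:)
    then have "(\<Sum>j\<le>?N. poly_xy (b j) x y * G (Suc j) x y + poly_xy (pderiv (b j)) x y * G j x y) = 0"
      by (rule DERIV_unique[OF _ DERIV_const])
    moreover have "(\<Sum>j\<le>Suc ?N. poly_xy (case j of 0 \<Rightarrow> 0 | Suc i \<Rightarrow> b i) x y * G j x y) =
        (\<Sum>j\<le>?N. poly_xy (b j) x y * G (Suc j) x y)"
      by (subst sum.atMost_Suc_shift) simp
    moreover have "(\<Sum>j\<le>Suc ?N. poly_xy (pderiv (b j)) x y * G j x y) =
        (\<Sum>j\<le>?N. poly_xy (pderiv (b j)) x y * G j x y)"
      using b(2)[of "Suc ?N"] by simp
    ultimately show "(\<Sum>j\<le>Suc ?N. poly_xy (?b j) x y * G j x y) = 0"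
      by (simp only: poly_xy_add distrib_right sum.distrib)
  qed
qed

text \<open>
  Formally \<open>L g = A (B g) = 0\<close> for \<open>L = A B\<close>, but \<open>A\<close> may have poles at \<open>(x\<^sub>0, y\<^sub>0)\<close> even though \<open>L\<close> is regular
  there. Write \<open>L = \<Sum>\<^sub>i a\<^sub>i/d \<partial>\<^sup>i B\<close> and \<open>L = \<Sum>\<^sub>j p\<^sub>j/q \<partial>\<^sup>j\<close> with \<open>q(x\<^sub>0, y\<^sub>0) \<noteq> 0\<close>. The operators \<open>\<partial>\<^sup>i B\<close> have
  polynomial coefficients and annihilate \<open>g\<close> everywhere, so \<open>d \<cdot> \<Sum>\<^sub>j p\<^sub>j \<partial>\<^sup>j g = 0\<close> everywhere, and \<open>d\<close>
  cancels. The zeros of \<open>d\<close> may contain a whole line \<open>x = x\<^sub>0\<close>, which is why \<open>g\<close> has to be known for all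
  parameters and to be continuous in \<open>x\<close>.
\<close>

lemma left_multiple_annihilates:
  assumes B: "annihilates_jet B G"
    and G: "\<And>j x y. (G j x has_field_derivative G (Suc j) x y) (at y)"
    and cont: "\<And>j y. continuous_on UNIV (\<lambda>x. G j x y)"
    and L: "left_multiple L B" and reg: "dop_regular L x0 y0"
  shows "dop_apply L x0 (G 0 x0) y0 = 0"
proof -
  obtain A where A: "L = dop_mult A B" using L unfolding left_multiple_def by blast
  define Bi where "Bi i = (D_mult ^^ i) B" for i
  have Bi: "annihilates_jet (Bi i) G" for i
    unfolding Bi_def by (induction i) (auto intro: B annihilates_jet_D_mult G)
  have "\<forall>i. \<exists>b. (\<forall>j. coeff (Bi i) j = Fract (b j) 1) \<and>
      (\<forall>N x y. degree (Bi i) \<le> N \<longrightarrow> (\<Sum>j\<le>N. poly_xy (b j) x y * G j x y) = 0)"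
  proof
    fix i
    show "\<exists>b. (\<forall>j. coeff (Bi i) j = Fract (b j) 1) \<and>
      (\<forall>N x y. degree (Bi i) \<le> N \<longrightarrow> (\<Sum>j\<le>N. poly_xy (b j) x y * G j x y) = 0)"
      by (rule annihilates_jetE[OF Bi[of i]]) blast
  qed
  then obtain b where b: "\<And>i j. coeff (Bi i) j = Fract (b i j) 1"
      "\<And>i N x y. degree (Bi i) \<le> N \<Longrightarrow> (\<Sum>j\<le>N. poly_xy (b i j) x y * G j x y) = 0"
    by (auto dest!: choice)
  define I where "I = {..degree A}"
  obtain a d where d: "d \<noteq> 0" and a: "\<And>i. i \<in> I \<Longrightarrow> coeff A i = Fract (a i) d"
  proof (rule common_denominator[of I "coeff A" "\<lambda>q. q \<noteq> 0"])
    show "\<exists>p q. coeff A i = Fract p q \<and> q \<noteq> 0" for i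
      by (cases "coeff A i") blast
  qed (auto simp: I_def)
  define N where "N = degree L + (\<Sum>i\<in>I. degree (Bi i))"
  have degB: "degree (Bi i) \<le> N" if "i \<in> I" for i
    using member_le_sum[of i I "\<lambda>i. degree (Bi i)"] that by (simp add: N_def I_def)
  obtain p q where q: "poly_xy q x0 y0 \<noteq> 0" and p: "\<And>j. j \<in> {..N} \<Longrightarrow> coeff L j = Fract (p j) q"
  proof (rule common_denominator[of "{..N}" "coeff L" "\<lambda>q. poly_xy q x0 y0 \<noteq> 0"])
    show "\<exists>p q. coeff L j = Fract p q \<and> poly_xy q x0 y0 \<noteq> 0" for j
      using reg unfolding dop_regular_def rf_regular_def by blast
    show "poly_xy 1 x0 y0 \<noteq> 0" by (simp add: poly_xy_def)
    show "poly_xy (a * b) x0 y0 \<noteq> 0" if "poly_xy a x0 y0 \<noteq> 0" "poly_xy b x0 y0 \<noteq> 0" for a b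
      using that by (simp add: poly_xy_mult)
  qed auto
  have q0: "q \<noteq> 0" using q by auto
  have clear: "p j * d = (\<Sum>i\<in>I. a i * b i j) * q" if "j \<le> N" for j
  proof -
    have "coeff L j = (\<Sum>i\<in>I. coeff A i * coeff (Bi i) j)"
      by (simp add: A dop_mult_def coeff_sum I_def Bi_def)
    also have "\<dots> = (\<Sum>i\<in>I. Fract (a i * b i j) d)"
      by (intro sum.cong) (simp_all add: a b)
    also have "\<dots> = Fract (\<Sum>i\<in>I. a i * b i j) d"
      by (rule Fract_sum_same[OF d])
    finally show ?thesis using p[of j] that d q0 by (simp add: eq_fract)
  qed
  have clear_xy: "poly_xy (p j) x y * poly_xy d x y =
      (\<Sum>i\<in>I. poly_xy (a i) x y * poly_xy (b i j) x y) * poly_xy q x y" if "j \<le> N" for j x y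
    using arg_cong[OF clear[OF that], of "\<lambda>p. poly_xy p x y"] by (simp only: poly_xy_mult poly_xy_sum)
  define S where "S x y = (\<Sum>j\<le>N. poly_xy (p j) x y * G j x y)" for x y
  have zero: "poly_xy d x y * S x y = 0" for x y
  proof -
    have "poly_xy d x y * S x y = (\<Sum>j\<le>N. (poly_xy (p j) x y * poly_xy d x y) * G j x y)"
      by (simp add: S_def sum_distrib_left mult_ac)
    also have "\<dots> = (\<Sum>j\<le>N. \<Sum>i\<in>I. poly_xy q x y * (poly_xy (a i) x y * (poly_xy (b i j) x y * G j x y)))"
      by (intro sum.cong refl, subst clear_xy)
        (auto simp: sum_distrib_left sum_distrib_right mult_ac)
    also have "\<dots> = (\<Sum>i\<in>I. poly_xy q x y * (poly_xy (a i) x y * (\<Sum>j\<le>N. poly_xy (b i j) x y * G j x y)))"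
      by (subst sum.swap) (simp add: sum_distrib_left)
    also have "\<dots> = 0" using b(2) degB by simp
    finally show ?thesis .
  qed
  have cy: "continuous_on UNIV (S x)" for x
  proof -
    have "continuous_on UNIV (G j x)" for j
      by (rule DERIV_continuous_on[where D = "G (Suc j) x"]) (rule has_field_derivative_at_within[OF G])
    then show ?thesis
      unfolding S_def[abs_def] poly_xy_eq_poly by (intro continuous_intros)
  qed
  have cx: "continuous_on UNIV (\<lambda>x. S x y)" for y
    unfolding S_def poly_xy_def by (intro continuous_intros cont)
  have S0: "S x0 y0 = 0"
    by (rule cancel_poly_xy[where S = S, OF d zero cx cy])
  have deriv: "(deriv ^^ j) (G 0 x0) = G j x0" for j
    by (induction j) (auto intro!: ext DERIV_imp_deriv G)
  have "dop_apply L x0 (G 0 x0) y0 = (\<Sum>j\<le>degree L. poly_xy (p j) x0 y0 / poly_xy q x0 y0 * G j x0 y0)"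
    unfolding dop_apply_def deriv using p q by (intro sum.cong) (auto simp: N_def rf_eval_Fract)
  also have "\<dots> = (\<Sum>j\<le>N. poly_xy (p j) x0 y0 / poly_xy q x0 y0 * G j x0 y0)"
  proof (rule sum.mono_neutral_left)
    have "p j = 0" if "j \<in> {..N} - {..degree L}" for j
      using p[of j] that q0 by (simp add: coeff_eq_0 Zero_fract_def eq_fract)
    then show "\<forall>j\<in>{..N} - {..degree L}. poly_xy (p j) x0 y0 / poly_xy q x0 y0 * G j x0 y0 = 0"
      by simp
  qed (auto simp: N_def)
  also have "\<dots> = S x0 y0 / poly_xy q x0 y0"
    by (simp add: S_def sum_divide_distrib)
  finally show ?thesis using S0 by simp
qed

section \<open>Annihilation of the columns and of the determinant\<close>

lemma annihilates_jet_P_op: "annihilates_jet (P_op M) (column_jet M 0)"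
proof -
  define b :: "complex poly poly poly" where "b = [:- [:[:0, 1:]:], of_nat (M + 1), [:0, 1:]:]"
  have coeffs: "coeff (P_op M) j = Fract (coeff b j) 1" for j
    by (auto simp: P_op_def b_def coeff_pCons rf_x_def rf_y_def Zero_fract_def
        Fract_of_nat_eq[symmetric] One_fract_def split: nat.split)
  have zero: "(\<Sum>j\<le>2. poly_xy (coeff b j) x y * column_jet M 0 j x y) = 0" for x y
    using column_jet_P_ode[of x M y]
    by (simp add: b_def numeral_2_eq_2 poly_xy_def)
  show ?thesis
    by (rule annihilates_jetI[OF coeffs _ zero]) (simp add: P_op_def)
qed

lemma annihilates_jet_Q_op:
  assumes "0 < p"
  shows "annihilates_jet (Q_op (M + Suc p) M) (column_jet M p)"
proof -
  define b :: "complex poly poly poly"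
    where "b = [:[:[:0, 1:]:], - ([:[:0, 1:]:] + of_nat (M + Suc p) + 1), of_nat M - [:0, 1:] + 2, [:0, 1:]:]"
  have two: "(2 :: ratfun) = Fract 2 1"
    using Fract_of_nat_eq[of 2, where ?'a = "complex poly poly"] by simp
  have coeffs: "coeff (Q_op (M + Suc p) M) j = Fract (coeff b j) 1" for j
    by (auto simp: Q_op_def b_def coeff_pCons rf_x_def rf_y_def Zero_fract_def
        Fract_of_nat_eq[symmetric] One_fract_def two split: nat.split)
  have zero: "(\<Sum>j\<le>3. poly_xy (coeff b j) x y * column_jet M p j x y) = 0" for x y
    using column_jet_Q_ode[OF assms, of x M y]
    by (simp add: b_def numeral_2_eq_2 numeral_3_eq_3 poly_xy_def algebra_simps)
  show ?thesis
    by (rule annihilates_jetI[OF coeffs _ zero]) (simp add: Q_op_def)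
qed

lemma annihilates_jet_T_op:
  "annihilates_jet (T_op n m (Suc p)) (column_jet (n - m) p)"
  using annihilates_jet_P_op annihilates_jet_Q_op[of p "n - m"] by (simp add: T_op_def)

lemma left_multiple_refl: "left_multiple B B"
  unfolding left_multiple_def by (rule exI[of _ "[:1:]"]) (simp add: dop_mult_def)

lemma dop_regular_of_annihilates_jet: "annihilates_jet B G \<Longrightarrow> dop_regular B x y"
  unfolding annihilates_jet_def dop_regular_def rf_regular_def
  by (metis poly_xy_def poly_1 zero_neq_one)

lemma left_multiple_annihilates_column:
  assumes "left_multiple L (T_op n m (Suc p))" and "dop_regular L x y"
  shows "dop_apply L x (column_jet (n - m) p 0 x) y = 0"
  using left_multiple_annihilates[OF annihilates_jet_T_op has_field_derivative_column_jet
      continuous_column_jet_x assms] .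

lemma holomorphic_column_jet: "column_jet M p j x holomorphic_on UNIV"
  by (auto simp: holomorphic_on_open intro: has_field_derivative_column_jet)

text \<open>
  Every term of the Leibniz expansion uses each column exactly once. In (i) the product over all
  variables therefore hits the factor from the column \<open>p = k - 1\<close> with the operator \<open>T\<^sub>k\<close> that kills it;
  in (ii) the factor in \<open>\<lambda>\<^sub>k\<close> comes from some column, and the LCLM kills them all.
\<close>

theorem theorem2p1:
  fixes n m :: nat
  assumes "1 \<le> m" and "m \<le> n"
  shows "(\<forall>k\<in>{1..m}. \<forall>x l. foldr (dop_act (T_op n m k) x) [1..<Suc m] (R_fun n m x) l = 0) \<and>
         (\<forall>k\<in>{1..m}. \<forall>L. is_LCLM (T_op n m ` {1..m}) L \<longrightarrow>
            (\<forall>x l. dop_regular L x (l k) \<longrightarrow> dop_act L x k (R_fun n m x) l = 0))"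
proof (intro conjI ballI allI impI)
  note R = R_fun_eq_sum_prod[OF assms]
  fix k x l assume k: "k \<in> {1..m}"
  let ?T = "T_op n m k" and ?f = "\<lambda>p i. column_jet (n - m) (m - Suc (p (i - 1))) 0 x"
  have "foldr (dop_act ?T x) [1..<Suc m] (R_fun n m x) l =
      (\<Sum>p | p permutes {0..<m}. signof p *
        (\<Prod>i\<in>{1..m}. (if i \<in> set [1..<Suc m] then dop_apply ?T x (?f p i) else ?f p i) (l i)))"
    unfolding R by (subst foldr_dop_act_sum_prod) (auto intro: holomorphic_column_jet)
  also have "\<dots> = 0"
  proof (intro sum.neutral ballI)
    fix p assume "p \<in> {p. p permutes {0..<m}}"
    then have p: "p permutes {0..<m}" by simp
    \<comment> \<open>The row whose factor comes from the column annihilated by \<open>T\<^sub>k\<close>.\<close>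
    define i where "i = Suc (Hilbert_Choice.inv p (m - k))"
    have "p (i - 1) = m - k"
      using permutes_inverses(1)[OF p] by (simp add: i_def)
    moreover have "i \<in> {1..m}"
      using permutes_in_image[OF permutes_inv[OF p], of "m - k"] k by (auto simp: i_def)
    moreover have "dop_apply ?T x (column_jet (n - m) (k - 1) 0 x) (l i) = 0"
      using k left_multiple_annihilates_column[of ?T n m "k - 1"]
        left_multiple_refl dop_regular_of_annihilates_jet[OF annihilates_jet_T_op[of n m "k - 1"]]
      by auto
    ultimately have "\<exists>i\<in>{1..m}. (if i \<in> set [1..<Suc m] then dop_apply ?T x (?f p i) else ?f p i) (l i) = 0"
      using k by (intro bexI[of _ i]) (auto simp: Suc_diff_Suc)
    then show "signof p *
        (\<Prod>i\<in>{1..m}. (if i \<in> set [1..<Suc m] then dop_apply ?T x (?f p i) else ?f p i) (l i)) = 0"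
      by (simp only: prod_zero[OF finite_atLeastAtMost] mult_zero_right)
  qed
  finally show "foldr (dop_act ?T x) [1..<Suc m] (R_fun n m x) l = 0" .
next
  note R = R_fun_eq_sum_prod[OF assms]
  fix k L x and l :: "nat \<Rightarrow> complex"
  assume k: "k \<in> {1..m}" and L: "is_LCLM (T_op n m ` {1..m}) L" and reg: "dop_regular L x (l k)"
  let ?f = "\<lambda>p i. column_jet (n - m) (m - Suc (p (i - 1))) 0 x"
  have "dop_act L x k (R_fun n m x) l =
      (\<Sum>p | p permutes {0..<m}. signof p *
        (\<Prod>i\<in>{1..m}. (if i = k then dop_apply L x (?f p i) else ?f p i) (l i)))"
    unfolding R using k by (subst dop_act_sum_prod) (auto intro: holomorphic_column_jet)
  also have "\<dots> = 0"
  proof (intro sum.neutral ballI)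
    fix p
    have "left_multiple L (T_op n m (Suc (m - Suc (p (k - 1)))))"
      using L assms unfolding is_LCLM_def by auto
    then have "dop_apply L x (?f p k) (l k) = 0"
      using reg by (rule left_multiple_annihilates_column)
    then have "\<exists>i\<in>{1..m}. (if i = k then dop_apply L x (?f p i) else ?f p i) (l i) = 0"
      using k by (intro bexI[of _ k]) auto
    then show "signof p *
        (\<Prod>i\<in>{1..m}. (if i = k then dop_apply L x (?f p i) else ?f p i) (l i)) = 0"
      by (simp only: prod_zero[OF finite_atLeastAtMost] mult_zero_right)
  qed
  finally show "dop_act L x k (R_fun n m x) l = 0" .
qed

end
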